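(* Let an equilateral triangle be tiled by $n$ equilateral triangles. Then there is a positive real $\lambda$ such that, after scaling the whole configuration by $\lambda$, the side length of the scaled big triangle is at most $4^{\frac{2n-2}{3}}$ and all triangular tiles have integer side lengths.
   Context: A tiling of a region by tiles means a finite family of closed tiles with pairwise disjoint interiors whose union is the region. *)

theory Defs
  imports "HOL-Analysis.Analysis"
begin

text \<open>Triangles are solid, closed and (since \<^term>\<open>s > 0\<close>) non-degenerate, in arbitrary position
  and orientation; the side length \<^term>\<open>s\<close> is determined by the triangle, being its diameter.\<close>

definition equilateral_triangle_with_side :: "(real ^ 2) set \<Rightarrow> real \<Rightarrow> bool" where
  "equilateral_triangle_with_side T s \<longleftrightarrow>
     s > 0 \<and> (\<exists>a b c. dist a b = s \<and> dist b c = s \<and> dist c a = s \<and> T = convex hull {a, b, c})"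

definition equilateral_triangle :: "(real ^ 2) set \<Rightarrow> bool" where
  "equilateral_triangle T \<longleftrightarrow> (\<exists>s. equilateral_triangle_with_side T s)"

text \<open>A family of tiles is rendered as a set of tiles: tiles with non-empty, pairwise disjoint
  interiors are distinct, so the number of tiles is the cardinality of the set.\<close>

definition tiling :: "'a::topological_space set set \<Rightarrow> 'a set \<Rightarrow> bool" where
  "tiling \<T> R \<longleftrightarrow>
     finite \<T> \<and> (\<forall>T\<in>\<T>. closed T) \<and>
     pairwise (\<lambda>S T. interior S \<inter> interior T = {}) \<T> \<and> \<Union>\<T> = R"

end

theory Submission
  imports Defs "Jordan_Normal_Form.Determinant"
begin

text \<open>All tiles are parallel to the big triangle: the parallel tiles together with the exterior, and the
  other tiles, are two closed sets that cover the plane and share only finitely many points.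

  Take one side of the big triangle as the ground. A tile has a base at some height \<open>b\<close> and an apex at some
  height \<open>a\<close>, and its size is proportional to \<open>\<bar>a - b\<bar>\<close>. The length of a horizontal slice of the big triangle
  is the sum of the lengths of the slices of the tiles. This length is an affine function of the height inside
  the big triangle, so for every inner height \<open>y\<close> the jumps at \<open>y\<close> cancel, i.e. the sum of \<open>a - b\<close> over the
  tiles with \<open>b = y\<close> is \<open>0\<close>, and so do the changes of slope, i.e. as many apexes as bases lie at \<open>y\<close>. Hence the
  height function is harmonic on the directed graph whose vertices are the heights of bases and whose arcs lead
  from the base to the apex of a tile. By the maximum principle the corresponding integer linear system is
  nonsingular, and by Cramer's rule its determinant is a common denominator of the heights. A row that
  belongs to \<open>d\<close> tiles has sum of absolute values at most \<open>2 d \<le> 4 powr (2 d / 3)\<close>, and the rows account for at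
  most \<open>n - 1\<close> tiles, since the tiles on the ground belong to no row.\<close>

section \<open>Equilateral triangles in the plane\<close>

text \<open>Over an edge \<open>v\<close> the third vertex has two possible places, mirror images in
  the line of \<open>v\<close>. The side lengths fix its inner product with \<open>v\<close> and, by
  Lagrange's identity, the square of its cross product with \<open>v\<close>; the sign of the latter
  decides between \<open>w\<close> and \<open>v - w\<close>.\<close>

lemma equilateral_third_vertex:
  fixes v w w' :: "real ^ 2"
  assumes "norm w = norm v" "norm (w - v) = norm v"
    and "norm w' = norm v" "norm (w' - v) = norm v"
  shows "w' = w \<or> w' = v - w"
proof -
  define x y p q p' q' where defs: "x = vec_nth v 1" "y = vec_nth v 2" "p = vec_nth w 1" "q = vec_nth w 2" "p' = vec_nth w' 1" "q' = vec_nth w' 2"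
  have sq: "(norm u)\<^sup>2 = (vec_nth u 1)\<^sup>2 + (vec_nth u 2)\<^sup>2" for u :: "real ^ 2"
    unfolding power2_norm_eq_inner by (simp add: inner_vec_def sum_2 power2_eq_square)
  have dist: "p\<^sup>2 + q\<^sup>2 = x\<^sup>2 + y\<^sup>2" "(p - x)\<^sup>2 + (q - y)\<^sup>2 = x\<^sup>2 + y\<^sup>2"
    "p'\<^sup>2 + q'\<^sup>2 = x\<^sup>2 + y\<^sup>2" "(p' - x)\<^sup>2 + (q' - y)\<^sup>2 = x\<^sup>2 + y\<^sup>2"
    using assms sq[of v] sq[of w] sq[of w'] sq[of "w - v"] sq[of "w' - v"] by (simp_all add: defs)
  have dots: "2 * (p*x + q*y) = x\<^sup>2 + y\<^sup>2" "2 * (p'*x + q'*y) = x\<^sup>2 + y\<^sup>2"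
    using dist by (simp_all add: power2_eq_square algebra_simps)
  have "(p*y - q*x)\<^sup>2 = (p\<^sup>2 + q\<^sup>2) * (x\<^sup>2 + y\<^sup>2) - (p*x + q*y)\<^sup>2"
    by (simp add: power2_eq_square algebra_simps)
  moreover have "(p'*y - q'*x)\<^sup>2 = (p'\<^sup>2 + q'\<^sup>2) * (x\<^sup>2 + y\<^sup>2) - (p'*x + q'*y)\<^sup>2"
    by (simp add: power2_eq_square algebra_simps)
  moreover have "p*x + q*y = p'*x + q'*y" using dots by simp
  ultimately have "(p*y - q*x)\<^sup>2 = (p'*y - q'*x)\<^sup>2" using dist by simp
  then consider "p'*y - q'*x = p*y - q*x" | "p'*y - q'*x = -(p*y - q*x)"
    by (metis power2_eq_iff minus_minus)
  then show ?thesis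
  proof cases
    case 1
    \<comment> \<open>The difference \<open>w' - w\<close> has zero inner product and zero cross
      product with \<open>v\<close>, so it vanishes or \<open>v = 0\<close>; in the degenerate case
      all three vectors are zero.\<close>
    have zero: "(p' - p)*y - (q' - q)*x = 0" "(p' - p)*x + (q' - q)*y = 0"
      using 1 dots by (simp_all add: algebra_simps)
    have "((p' - p)\<^sup>2 + (q' - q)\<^sup>2) * (x\<^sup>2 + y\<^sup>2)
        = ((p' - p)*y - (q' - q)*x)\<^sup>2 + ((p' - p)*x + (q' - q)*y)\<^sup>2"
      by (simp add: power2_eq_square algebra_simps)
    then have "(p' - p)\<^sup>2 + (q' - q)\<^sup>2 = 0 \<or> x\<^sup>2 + y\<^sup>2 = 0" using zero by simp
    then have "p' = p \<and> q' = q" using dist by (auto simp: sum_power2_eq_zero_iff)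
    then show ?thesis by (simp add: defs Finite_Cartesian_Product.vec_eq_iff forall_2)
  next
    case 2
    have zero: "(p' + p - x)*y - (q' + q - y)*x = 0" "(p' + p - x)*x + (q' + q - y)*y = 0"
      using 2 dots by (simp_all add: algebra_simps power2_eq_square)
    have "((p' + p - x)\<^sup>2 + (q' + q - y)\<^sup>2) * (x\<^sup>2 + y\<^sup>2)
        = ((p' + p - x)*y - (q' + q - y)*x)\<^sup>2 + ((p' + p - x)*x + (q' + q - y)*y)\<^sup>2"
      by (simp add: power2_eq_square algebra_simps)
    then have "(p' + p - x)\<^sup>2 + (q' + q - y)\<^sup>2 = 0 \<or> x\<^sup>2 + y\<^sup>2 = 0" using zero by simp
    then have "p' = x - p \<and> q' = y - q" using dist by (auto simp: sum_power2_eq_zero_iff)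
    then show ?thesis by (simp add: defs Finite_Cartesian_Product.vec_eq_iff forall_2)
  qed
qed

text \<open>Two distinct common points suffice: their difference is a nonzero multiple of
  \<open>b - a\<close> and also a multiple of \<open>d - c\<close>.\<close>

lemma infinite_segment_Int_imp_parallel:
  fixes a b c d :: "'a::real_normed_vector"
  assumes "infinite (closed_segment a b \<inter> closed_segment c d)"
  shows "\<exists>k. b - a = k *\<^sub>R (d - c)"
proof -
  obtain x where x: "x \<in> closed_segment a b \<inter> closed_segment c d"
    using assms by (metis finite.emptyI all_not_in_conv)
  have "infinite (closed_segment a b \<inter> closed_segment c d - {x})"
    using assms by simp
  then obtain y where y: "y \<in> closed_segment a b \<inter> closed_segment c d" "y \<noteq> x"
    by (metis Diff_iff all_not_in_conv finite.emptyI singletonI)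
  have line: "\<exists>r. x = a + r *\<^sub>R (b - a)" if seg: "x \<in> closed_segment a b" for a b x :: 'a
  proof -
    obtain r where "x = (1 - r) *\<^sub>R a + r *\<^sub>R b" using seg unfolding in_segment by blast
    then have "x = a + r *\<^sub>R (b - a)" by (simp add: algebra_simps)
    then show ?thesis ..
  qed
  obtain r r' where r: "x = a + r *\<^sub>R (b - a)" "y = a + r' *\<^sub>R (b - a)"
    using x y line by blast
  obtain t t' where t: "x = c + t *\<^sub>R (d - c)" "y = c + t' *\<^sub>R (d - c)"
    using x y line by blast
  have ne: "r' - r \<noteq> 0" using r y by auto
  have "(r' - r) *\<^sub>R (b - a) = y - x" by (simp only: r) (simp add: algebra_simps)
  also have "\<dots> = (t' - t) *\<^sub>R (d - c)" by (simp only: t) (simp add: algebra_simps)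
  finally have "(1 / (r' - r)) *\<^sub>R (r' - r) *\<^sub>R (b - a) = (1 / (r' - r)) *\<^sub>R (t' - t) *\<^sub>R (d - c)"
    by simp
  then have "b - a = ((t' - t) / (r' - r)) *\<^sub>R (d - c)" using ne by simp
  then show ?thesis ..
qed

section \<open>Oblique coordinates along two edges of a reference triangle\<close>

locale equilateral_frame =
  fixes e f :: "real ^ 2" and s :: real
  assumes side_pos: "s > 0"
    and norm_frame: "norm e = s" "norm f = s" "norm (f - e) = s"
begin

text \<open>The scale is signed: a negative \<open>\<mu>\<close> turns the triangle upside down, so
  one formula covers both orientations of a parallel tile.\<close>

definition tri :: "real ^ 2 \<Rightarrow> real \<Rightarrow> (real ^ 2) set" where
  "tri a \<mu> = convex hull {a, a + \<mu> *\<^sub>R e, a + \<mu> *\<^sub>R f}"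

definition aligned :: "(real ^ 2) set \<Rightarrow> bool" where
  "aligned T \<longleftrightarrow> (\<exists>a \<mu>. \<mu> \<noteq> 0 \<and> T = tri a \<mu>)"

text \<open>The condition on \<open>f - e\<close> forces twice the inner product of \<open>e\<close>
  and \<open>f\<close> to be the square of \<open>s\<close>. The resulting form is positive
  definite, which makes \<open>e\<close> and \<open>f\<close> independent.\<close>

lemma norm_frame_comb: "(norm (x *\<^sub>R e + y *\<^sub>R f))\<^sup>2 = s\<^sup>2 * (x\<^sup>2 + x*y + y\<^sup>2)"
proof -
  have ee: "inner e e = s\<^sup>2" "inner f f = s\<^sup>2" "inner (f - e) (f - e) = s\<^sup>2"
    using norm_frame by (metis power2_norm_eq_inner)+
  then have ef: "2 * inner e f = s\<^sup>2" by (simp add: inner_diff inner_commute algebra_simps)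
  have "(norm (x *\<^sub>R e + y *\<^sub>R f))\<^sup>2 = x\<^sup>2 * inner e e + x * y * (2 * inner e f) + y\<^sup>2 * inner f f"
    unfolding power2_norm_eq_inner
    by (simp add: inner_add inner_commute algebra_simps power2_eq_square)
  then show ?thesis unfolding ee ef by (simp add: algebra_simps)
qed

lemma frame_independent:
  assumes "x *\<^sub>R e + y *\<^sub>R f = 0" shows "x = 0 \<and> y = 0"
proof -
  have "s\<^sup>2 * (x\<^sup>2 + x*y + y\<^sup>2) = 0" using norm_frame_comb[of x y] assms by simp
  then have "x\<^sup>2 + x*y + y\<^sup>2 = 0" using side_pos by simp
  moreover have "2 * (x\<^sup>2 + x*y + y\<^sup>2) = x\<^sup>2 + y\<^sup>2 + (x + y)\<^sup>2"
    by (simp add: power2_eq_square algebra_simps)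
  ultimately have "x\<^sup>2 + y\<^sup>2 + (x + y)\<^sup>2 = 0" by simp
  then have "x\<^sup>2 = 0" "y\<^sup>2 = 0"
    by (smt (verit) zero_le_power2)+
  then show ?thesis by simp
qed

lemma frame_cancel: "x *\<^sub>R e + y *\<^sub>R f = x' *\<^sub>R e + y' *\<^sub>R f \<longleftrightarrow> x = x' \<and> y = y'"
proof
  assume "x *\<^sub>R e + y *\<^sub>R f = x' *\<^sub>R e + y' *\<^sub>R f"
  then have "(x - x') *\<^sub>R e + (y - y') *\<^sub>R f = 0" by (simp add: algebra_simps)
  from frame_independent[OF this] show "x = x' \<and> y = y'" by simp
qed simp

text \<open>Three edge directions with two positions of the third vertex each give six cases. In
  each, some vertex serves as the corner from which the other two are reached by the same multiple,
  \<open>k\<close> or \<open>-k\<close>, of \<open>e\<close> and \<open>f\<close>.\<close>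

lemma aligned_if_parallel_edge:
  assumes T: "dist a b = t" "dist b c = t" "dist c a = t" "t > 0" 
    and par: "b - a = k *\<^sub>R g" and g: "g = e \<or> g = f \<or> g = f - e"
  shows "aligned (convex hull {a, b, c})"
proof -
  define v w where "v = b - a" and "w = c - a"
  have nv: "norm v = t" "norm w = t" "norm (w - v) = t"
    using T by (auto simp: v_def w_def dist_norm norm_minus_commute)
  have k0: "k \<noteq> 0" using par nv T by (auto simp: v_def)
  have ng: "norm g = s" using g norm_frame by auto
  have kt: "\<bar>k\<bar> * s = t" using nv par ng by (simp add: v_def)
  have vk: "v = k *\<^sub>R g" using par by (simp add: v_def)
  have b: "b = a + v" and c: "c = a + w" by (auto simp: v_def w_def)
  have third: "w = k *\<^sub>R h \<or> w = v - k *\<^sub>R h" if "norm h = s" "norm (h - g) = s" for h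
  proof -
    have "norm (k *\<^sub>R h - v) = t" 
    proof -
      have "k *\<^sub>R h - v = k *\<^sub>R (h - g)" using par by (simp add: v_def algebra_simps)
      then show ?thesis using that kt by simp
    qed
    then show ?thesis using equilateral_third_vertex[of "k *\<^sub>R h" v w] nv that kt by simp
  qed
  have goal: "aligned (convex hull {p, q, r})" 
    if "m \<noteq> 0" "q = p + m *\<^sub>R e" "r = p + m *\<^sub>R f" for p q r m
    using that unfolding aligned_def tri_def by blast
  from g consider "g = e" | "g = f" | "g = f - e" by blast
  then show ?thesis
  proof cases
    case 1
    from third[of f] norm_frame 1 consider "w = k *\<^sub>R f" | "w = v - k *\<^sub>R f" by auto
    then show ?thesis
    proof cases
      case w: 1
      have "aligned (convex hull {a, b, c})"
        by (intro goal[of "k"]) (use k0 in \<open>simp_all add: b c vk \<open>g = e\<close> w algebra_simps\<close>)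
      then show ?thesis by (simp only: insert_commute)
    next
      case w: 2
      have "aligned (convex hull {b, a, c})"
        by (intro goal[of "-k"]) (use k0 in \<open>simp_all add: b c vk \<open>g = e\<close> w algebra_simps\<close>)
      then show ?thesis by (simp only: insert_commute)
    qed
  next
    case 2
    from third[of e] norm_frame 2 consider "w = k *\<^sub>R e" | "w = v - k *\<^sub>R e" by (auto simp: norm_minus_commute)
    then show ?thesis
    proof cases
      case w: 1
      have "aligned (convex hull {a, c, b})"
        by (intro goal[of "k"]) (use k0 in \<open>simp_all add: b c vk \<open>g = f\<close> w algebra_simps\<close>)
      then show ?thesis by (simp only: insert_commute)
    next
      case w: 2
      have "aligned (convex hull {b, c, a})"
        by (intro goal[of "-k"]) (use k0 in \<open>simp_all add: b c vk \<open>g = f\<close> w algebra_simps\<close>)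
      then show ?thesis by (simp only: insert_commute)
    qed
  next
    case 3
    from third[of f] norm_frame 3 consider "w = k *\<^sub>R f" | "w = v - k *\<^sub>R f" by (auto simp: norm_minus_commute)
    then show ?thesis
    proof cases
      case w: 1
      have "aligned (convex hull {c, b, a})"
        by (intro goal[of "-k"]) (use k0 in \<open>simp_all add: b c vk \<open>g = f - e\<close> w algebra_simps\<close>)
      then show ?thesis by (simp only: insert_commute)
    next
      case w: 2
      have "aligned (convex hull {c, a, b})"
        by (intro goal[of "k"]) (use k0 in \<open>simp_all add: b c vk \<open>g = f - e\<close> w algebra_simps\<close>)
      then show ?thesis by (simp only: insert_commute)
    qed
  qed
qed

end

text \<open>A convex set with inner points lies in the closure of its interior, so an open set that
  misses the interior of \<open>T\<close> misses \<open>T\<close>.\<close>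

lemma subset_frontier_if_disjoint_interior:
  fixes S T :: "'a::euclidean_space set"
  assumes "convex T" "interior T \<noteq> {}" "interior S \<inter> interior T = {}" "closed S"
  shows "S \<inter> T \<subseteq> frontier S"
proof -
  have "interior S \<inter> closure (interior T) = {}"
    using assms(3) open_Int_closure_eq_empty[of "interior S" "interior T"] by simp
  then have "interior S \<inter> T = {}"
    using convex_closure_interior[OF assms(1,2)] closure_subset[of T] by auto
  then show ?thesis using assms(4) by (auto simp: frontier_def)
qed

context equilateral_frame
begin

lemma mem_tri_iff:
  assumes "\<mu> \<noteq> 0"
  shows "a + x *\<^sub>R e + y *\<^sub>R f \<in> tri a \<mu> \<longleftrightarrow> 0 \<le> x / \<mu> \<and> 0 \<le> y / \<mu> \<and> x / \<mu> + y / \<mu> \<le> 1"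
proof
  assume "a + x *\<^sub>R e + y *\<^sub>R f \<in> tri a \<mu>"
  then obtain u v where uv: "0 \<le> u" "0 \<le> v" "u + v \<le> 1"
    and "a + x *\<^sub>R e + y *\<^sub>R f = a + u *\<^sub>R (\<mu> *\<^sub>R e) + v *\<^sub>R (\<mu> *\<^sub>R f)"
    unfolding tri_def convex_hull_3_alt by auto
  then have "x *\<^sub>R e + y *\<^sub>R f = (u * \<mu>) *\<^sub>R e + (v * \<mu>) *\<^sub>R f" by (simp add: add.assoc)
  then have "x = u * \<mu>" "y = v * \<mu>" by (simp_all add: frame_cancel)
  then show "0 \<le> x / \<mu> \<and> 0 \<le> y / \<mu> \<and> x / \<mu> + y / \<mu> \<le> 1" using uv assms by simp
next
  assume xy: "0 \<le> x / \<mu> \<and> 0 \<le> y / \<mu> \<and> x / \<mu> + y / \<mu> \<le> 1"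
  have "a + x *\<^sub>R e + y *\<^sub>R f = a + (x / \<mu>) *\<^sub>R ((a + \<mu> *\<^sub>R e) - a) + (y / \<mu>) *\<^sub>R ((a + \<mu> *\<^sub>R f) - a)"
    using assms by simp
  then show "a + x *\<^sub>R e + y *\<^sub>R f \<in> tri a \<mu>"
    unfolding tri_def convex_hull_3_alt using xy by blast
qed

lemma not_collinear_tri:
  assumes "\<mu> \<noteq> 0" shows "\<not> collinear {a, a + \<mu> *\<^sub>R e, a + \<mu> *\<^sub>R f}"
proof
  assume "collinear {a, a + \<mu> *\<^sub>R e, a + \<mu> *\<^sub>R f}"
  then have "collinear {a + \<mu> *\<^sub>R e, a, a + \<mu> *\<^sub>R f}" by (simp add: insert_commute)
  then have "collinear {0, \<mu> *\<^sub>R e, \<mu> *\<^sub>R f}" by (subst (asm) collinear_3) simp_all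
  moreover have "e \<noteq> 0" "f \<noteq> 0" using norm_frame side_pos by auto
  ultimately obtain c where "\<mu> *\<^sub>R f = c *\<^sub>R (\<mu> *\<^sub>R e)"
    unfolding collinear_lemma using assms by auto
  then have "0 *\<^sub>R e + \<mu> *\<^sub>R f = (c * \<mu>) *\<^sub>R e + 0 *\<^sub>R f" by simp
  then have "\<mu> = 0" unfolding frame_cancel by simp
  then show False using assms by simp
qed

lemma interior_triI:
  assumes "\<mu> \<noteq> 0" and xy: "0 < x / \<mu>" "0 < y / \<mu>" "x / \<mu> + y / \<mu> < 1"
  shows "a + x *\<^sub>R e + y *\<^sub>R f \<in> interior (tri a \<mu>)"
proof -
  have "(1 - x / \<mu> - y / \<mu>) *\<^sub>R a + (x / \<mu>) *\<^sub>R (a + \<mu> *\<^sub>R e) + (y / \<mu>) *\<^sub>R (a + \<mu> *\<^sub>R f)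
      = a + x *\<^sub>R e + y *\<^sub>R f"
    using assms(1) by (simp add: algebra_simps)
  moreover have "0 < 1 - x / \<mu> - y / \<mu>" using xy by simp
  ultimately show ?thesis
    unfolding tri_def interior_convex_hull_3_minimal[OF not_collinear_tri[OF assms(1)], simplified]
    using xy by (smt (verit, best) mem_Collect_eq)
qed

lemma interior_tri_nonempty: "\<mu> \<noteq> 0 \<Longrightarrow> interior (tri a \<mu>) \<noteq> {}"
  using interior_triI[of \<mu> "\<mu>/3" "\<mu>/3" a] by force

lemma convex_tri: "convex (tri a \<mu>)" and compact_tri: "compact (tri a \<mu>)"
  by (auto simp: tri_def finite_imp_compact_convex_hull)

lemma triangle_with_side_tri:
  assumes "\<mu> \<noteq> 0" shows "equilateral_triangle_with_side (tri a \<mu>) (\<bar>\<mu>\<bar> * s)"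
proof -
  have "dist (a + \<mu> *\<^sub>R e) (a + \<mu> *\<^sub>R f) = \<bar>\<mu>\<bar> * s"
  proof -
    have "dist (a + \<mu> *\<^sub>R e) (a + \<mu> *\<^sub>R f) = norm (\<mu> *\<^sub>R (f - e))"
      by (simp add: dist_norm norm_minus_commute algebra_simps)
    then show ?thesis by (simp add: norm_frame)
  qed
  moreover have "dist a (a + \<mu> *\<^sub>R e) = \<bar>\<mu>\<bar> * s" "dist (a + \<mu> *\<^sub>R f) a = \<bar>\<mu>\<bar> * s"
    by (simp_all add: dist_norm norm_frame)
  ultimately show ?thesis
    unfolding equilateral_triangle_with_side_def tri_def using assms side_pos by (metis abs_0_eq abs_ge_zero mult_pos_pos order_le_less)
qed

lemma scaled_tri: "(\<lambda>x. c *\<^sub>R x) ` tri a \<mu> = tri (c *\<^sub>R a) (c * \<mu>)"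
  unfolding tri_def by (simp add: convex_hull_scaling[symmetric] scaleR_add_right)

end

text \<open>A triangle is taken as its own frame, with scale 1; this transfers facts about
  \<open>tri\<close> to all equilateral triangles.\<close>

lemma equilateral_triangle_frame:
  assumes "equilateral_triangle_with_side T s"
  obtains a e f where "equilateral_frame e f s" "T = equilateral_frame.tri e f a 1"
proof -
  obtain a b c where abc: "dist a b = s" "dist b c = s" "dist c a = s" "T = convex hull {a, b, c}" "s > 0"
    using assms unfolding equilateral_triangle_with_side_def by auto
  have fr: "equilateral_frame (b - a) (c - a) s"
    by unfold_locales (use abc in \<open>auto simp: dist_norm norm_minus_commute\<close>)
  moreover have "T = equilateral_frame.tri (b - a) (c - a) a 1"
    unfolding equilateral_frame.tri_def[OF fr] using abc by simp
  ultimately show thesis using that by blast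
qed

lemma equilateral_triangle_props:
  assumes "equilateral_triangle T"
  shows "convex T" "compact T" "interior T \<noteq> {}"
proof -
  obtain s where "equilateral_triangle_with_side T s" using assms unfolding equilateral_triangle_def by auto
  then obtain a e f where fr: "equilateral_frame e f s" "T = equilateral_frame.tri e f a 1"
    by (rule equilateral_triangle_frame)
  then show "convex T" "compact T" "interior T \<noteq> {}"
    using equilateral_frame.convex_tri[OF fr(1)] equilateral_frame.compact_tri[OF fr(1)]
      equilateral_frame.interior_tri_nonempty[OF fr(1)] by auto
qed

section \<open>All tiles are parallel to the big triangle\<close>

context equilateral_frame
begin

text \<open>Edges with infinitely many common points are parallel, and a single edge parallel to the
  frame would already make \<open>T\<close> aligned.\<close>

lemma finite_frontier_Int_if_not_aligned:
  assumes "equilateral_triangle T" "\<not> aligned T" "\<mu> \<noteq> 0"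
  shows "finite (frontier T \<inter> frontier (tri p \<mu>))"
proof -
  obtain a b c t where abc: "dist a b = t" "dist b c = t" "dist c a = t" "t > 0" "T = convex hull {a, b, c}"
    using assms unfolding equilateral_triangle_def equilateral_triangle_with_side_def by auto
  have fin: "finite (closed_segment x y \<inter> closed_segment u v)"
    if xyz: "dist x y = t" "dist y z = t" "dist z x = t" "T = convex hull {x, y, z}"
      and uv: "v - u = k *\<^sub>R g" "g = e \<or> g = f \<or> g = f - e" for x y z u v k g
  proof (rule ccontr)
    assume "infinite (closed_segment x y \<inter> closed_segment u v)"
    then obtain r where "y - x = r *\<^sub>R (v - u)" using infinite_segment_Int_imp_parallel by blast
    then have "y - x = (r * k) *\<^sub>R g" using uv(1) by simp
    then show False
      using aligned_if_parallel_edge[OF xyz(1-3) abc(4) _ uv(2)] xyz(4) assms(2) by blast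
  qed
  have edge: "finite (closed_segment x y \<inter> frontier (tri p \<mu>))"
    if xyz: "dist x y = t" "dist y z = t" "dist z x = t" "T = convex hull {x, y, z}" for x y z
  proof -
    have "finite (closed_segment x y \<inter> closed_segment p (p + \<mu> *\<^sub>R e))"
      by (rule fin[OF xyz, of _ _ \<mu> e]) auto
    moreover have "finite (closed_segment x y \<inter> closed_segment (p + \<mu> *\<^sub>R e) (p + \<mu> *\<^sub>R f))"
      by (rule fin[OF xyz, of _ _ \<mu> "f - e"]) (auto simp: algebra_simps)
    moreover have "finite (closed_segment x y \<inter> closed_segment (p + \<mu> *\<^sub>R f) p)"
      by (rule fin[OF xyz, of _ _ "-\<mu>" f]) auto
    ultimately show ?thesis
      unfolding tri_def by (subst frontier_of_triangle) (auto simp: Int_Un_distrib)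
  qed
  have "frontier T = closed_segment a b \<union> closed_segment b c \<union> closed_segment c a"
    unfolding abc(5) by (rule frontier_of_triangle) simp
  moreover have "{b, c, a} = {a, b, c}" "{c, a, b} = {a, b, c}" by auto
  ultimately show ?thesis
    using edge[of a b c] edge[of b c a] edge[of c a b] abc by (auto simp: Int_Un_distrib2)
qed

lemma all_tiles_aligned:
  assumes til: "tiling \<T> (tri A 1)" and eq: "\<forall>T\<in>\<T>. equilateral_triangle T" and "T \<in> \<T>"
  shows "aligned T"
proof (rule ccontr)
  assume "\<not> aligned T"
  define \<Delta> where "\<Delta> = tri A 1"
  define N where "N = {T \<in> \<T>. \<not> aligned T}"
  define V where "V = \<Union>N"
  \<comment> \<open>Using the complement of the interior keeps \<open>U\<close> closed and makes it
    unbounded, even if no tile is aligned.\<close>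
  define U where "U = - interior \<Delta> \<union> \<Union>(\<T> - N)"
  have fin: "finite \<T>" and cl: "\<And>T. T \<in> \<T> \<Longrightarrow> closed T" and un: "\<Union>\<T> = \<Delta>"
    and dj: "\<And>S T. S \<in> \<T> \<Longrightarrow> T \<in> \<T> \<Longrightarrow> S \<noteq> T \<Longrightarrow> interior S \<inter> interior T = {}"
    using til unfolding tiling_def \<Delta>_def pairwise_def by auto
  have "T \<in> N" using assms \<open>\<not> aligned T\<close> by (simp add: N_def)
  have clU: "closed U" and clV: "closed V"
    unfolding U_def V_def using fin cl by (auto intro!: closed_Union simp: N_def)
  have cov: "U \<union> V = UNIV"
    using un interior_subset[of \<Delta>] by (auto simp: U_def V_def)
  have "finite (U \<inter> V)"
  proof -
    have out: "finite (- interior \<Delta> \<inter> S)" if "S \<in> N" for S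
    proof -
      have "S \<in> \<T>" "equilateral_triangle S" "\<not> aligned S" using that eq by (auto simp: N_def)
      then have "S \<subseteq> \<Delta>" using un by auto
      then have "interior S \<subseteq> interior \<Delta>" by (rule interior_mono)
      \<comment> \<open>A point of \<open>S\<close> outside the interior of the big triangle is
        outside the interior of \<open>S\<close> too, so it lies on both frontiers.\<close>
      have "- interior \<Delta> \<inter> S \<subseteq> frontier S \<inter> frontier \<Delta>"
        using \<open>S \<subseteq> \<Delta>\<close> \<open>interior S \<subseteq> interior \<Delta>\<close> cl[OF \<open>S \<in> \<T>\<close>] closure_subset[of \<Delta>] 
        by (auto simp: frontier_def)
      then show ?thesis
        by (rule finite_subset)
          (use finite_frontier_Int_if_not_aligned[OF \<open>equilateral_triangle S\<close> \<open>\<not> aligned S\<close>, of 1 A]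
            in \<open>simp add: \<Delta>_def\<close>)
    qed
    have ins: "finite (R \<inter> S)" if "S \<in> N" "R \<in> \<T> - N" for R S
    proof -
      have S: "S \<in> \<T>" "equilateral_triangle S" "\<not> aligned S" using that eq by (auto simp: N_def)
      have R: "R \<in> \<T>" "equilateral_triangle R" "aligned R" using that eq by (auto simp: N_def)
      then obtain p \<mu> where p: "R = tri p \<mu>" "\<mu> \<noteq> 0" unfolding aligned_def by auto
      have ne: "R \<noteq> S" using that by auto
      have "R \<inter> S \<subseteq> frontier S \<inter> frontier R"
        using subset_frontier_if_disjoint_interior[of S R] subset_frontier_if_disjoint_interior[of R S]
          equilateral_triangle_props[OF S(2)] equilateral_triangle_props[OF R(2)] 
          dj[OF R(1) S(1) ne] cl S(1) R(1)
        by (auto simp: Int_commute)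
      then show ?thesis
        by (rule finite_subset)
          (use finite_frontier_Int_if_not_aligned[OF S(2,3) p(2), of p] p in simp)
    qed
    have "U \<inter> V \<subseteq> (\<Union>S\<in>N. - interior \<Delta> \<inter> S) \<union> (\<Union>S\<in>N. \<Union>R\<in>\<T>-N. R \<inter> S)"
      by (auto simp: U_def V_def)
    moreover have "finite \<dots>"
      using fin by (intro finite_UnI finite_UN_I out ins finite_Diff) (auto simp: N_def)
    ultimately show ?thesis by (rule finite_subset)
  qed
  \<comment> \<open>The plane stays connected after deleting finitely many points, and on the rest
    the closed sets \<open>U\<close> and \<open>V\<close> are disjoint. So one of them is contained
    in the finite set \<open>U \<inter> V\<close>, although both are infinite.\<close>
  then have "connected (UNIV - U \<inter> V)"
    using connected_open_delete_finite[of "UNIV :: (real^2) set" "U \<inter> V"] connected_UNIV by simp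
  then have "U \<inter> (UNIV - U \<inter> V) = {} \<or> V \<inter> (UNIV - U \<inter> V) = {}"
    unfolding connected_closed using clU clV cov by blast
  then have "U \<subseteq> U \<inter> V \<or> V \<subseteq> U \<inter> V" by blast
  then have "finite U \<or> finite V" using \<open>finite (U \<inter> V)\<close> finite_subset by blast
  moreover have "infinite U"
  proof
    assume "finite U"
    then have "bounded (U \<union> \<Delta>)" using compact_tri[of A 1] by (simp add: \<Delta>_def compact_imp_bounded finite_imp_bounded)
    moreover have "U \<union> \<Delta> = UNIV" using interior_subset[of \<Delta>] by (auto simp: U_def)
    ultimately show False using not_bounded_UNIV by simp
  qed
  moreover have "infinite V"
  proof
    assume "finite V"
    then have "finite T" using \<open>T \<in> N\<close> by (auto simp: V_def intro: finite_subset)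
    then show False using equilateral_triangle_props(3)[of T] eq assms(3) empty_interior_finite by blast
  qed
  ultimately show False by blast
qed

end

section \<open>Slices at a fixed height\<close>

text \<open>The horizontal section at height \<open>y\<close> of a triangle with base at height
  \<open>b\<close> and apex at height \<open>a\<close>, measured in units of the frame.
  \<open>a < b\<close> describes a triangle pointing down.\<close>

definition slice_length :: "real \<Rightarrow> real \<Rightarrow> real \<Rightarrow> real" where
  "slice_length a b y = (if min a b \<le> y \<and> y \<le> max a b then \<bar>a - y\<bar> else 0)"

text \<open>If \<open>F\<close> is affine on either side of \<open>y\<close>, the two brackets
  extrapolate its one-sided limits at \<open>y\<close>.\<close>

definition jump :: "(real \<Rightarrow> real) \<Rightarrow> real \<Rightarrow> real \<Rightarrow> real" where
  "jump F \<epsilon> y = (2 * F (y + \<epsilon>) - F (y + 2 * \<epsilon>)) - (2 * F (y - \<epsilon>) - F (y - 2 * \<epsilon>))"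

text \<open>For such an \<open>F\<close> this is \<open>\<epsilon>\<close> times the change of slope
  at \<open>y\<close>. Neither formula uses the value at \<open>y\<close> itself.\<close>

definition kink :: "(real \<Rightarrow> real) \<Rightarrow> real \<Rightarrow> real \<Rightarrow> real" where
  "kink F \<epsilon> y = (F (y + 2 * \<epsilon>) - F (y + \<epsilon>)) - (F (y - \<epsilon>) - F (y - 2 * \<epsilon>))"

text \<open>In both orientations the slope rises by 1 at the apex and drops by 1 at the base,
  whereas the jump at the base carries the sign of \<open>a - b\<close>. The distance hypotheses
  keep the two sample points on each side of \<open>y\<close> on one affine piece.\<close>

lemma
  assumes "a \<noteq> b" "\<epsilon> > 0" "a \<noteq> y \<Longrightarrow> \<bar>a - y\<bar> > 2 * \<epsilon>" "b \<noteq> y \<Longrightarrow> \<bar>b - y\<bar> > 2 * \<epsilon>"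
  shows jump_slice_length: "jump (slice_length a b) \<epsilon> y = (if b = y then a - b else 0)"
    and kink_slice_length: "kink (slice_length a b) \<epsilon> y = \<epsilon> * (of_bool (a = y) - of_bool (b = y))"
proof -
  have ab: "a = y \<or> a > y + 2 * \<epsilon> \<or> a < y - 2 * \<epsilon>" "b = y \<or> b > y + 2 * \<epsilon> \<or> b < y - 2 * \<epsilon>"
    using assms(3,4) by linarith+
  show "jump (slice_length a b) \<epsilon> y = (if b = y then a - b else 0)"
    using ab by (elim disjE) (use assms(1,2) in \<open>simp_all add: jump_def slice_length_def min_def max_def\<close>)
  show "kink (slice_length a b) \<epsilon> y = \<epsilon> * (of_bool (a = y) - of_bool (b = y))"
    using ab by (elim disjE) (use assms(1,2) in \<open>simp_all add: kink_def slice_length_def min_def max_def\<close>)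
qed

text \<open>\<open>jump\<close> and \<open>kink\<close> are linear in the function, so they can be
  applied to both sides of the slice identity. The big triangle contributes its base at 0 and its
  apex at 1.\<close>

lemma
  fixes a b :: "'i \<Rightarrow> real"
  assumes fin: "finite I" "finite E" and ne: "\<And>i. i \<in> I \<Longrightarrow> a i \<noteq> b i"
    and slices: "\<And>y. y \<notin> E \<Longrightarrow> (\<Sum>i\<in>I. slice_length (a i) (b i) y) = slice_length 1 0 y"
  shows base_balance: "(\<Sum>i | i \<in> I \<and> b i = y. a i - b i) = of_bool (y = 0)"
    and apex_balance: "int (card {i \<in> I. a i = y}) - int (card {i \<in> I. b i = y})
      = of_bool (y = 1) - of_bool (y = 0)"
proof -
  \<comment> \<open>All breakpoints and exceptional heights other than \<open>y\<close>. They keep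
    distance at least \<open>d\<close> from \<open>y\<close>, and \<open>\<epsilon> = d / 3\<close>
    makes \<open>2 * \<epsilon>\<close> smaller than \<open>d\<close>.\<close>
  define P where "P = (a ` I \<union> b ` I \<union> E \<union> {0, 1}) - {y}"
  have "finite P" using fin by (simp add: P_def)
  then obtain d where d: "d > 0" "\<And>x. x \<in> P \<Longrightarrow> d \<le> dist y x"
    using finite_set_avoid[of P y] by (auto simp: P_def)
  define \<epsilon> where "\<epsilon> = d / 3"
  have \<epsilon>: "\<epsilon> > 0" using d by (simp add: \<epsilon>_def)
  have far: "2 * \<epsilon> < \<bar>x - y\<bar>" if "x \<in> P" for x
    using d(1) d(2)[OF that] unfolding \<epsilon>_def dist_real_def by linarith
  define F where "F z = (\<Sum>i\<in>I. slice_length (a i) (b i) z)" for z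
  \<comment> \<open>The slice identity may fail at \<open>y\<close>, but it is only needed at the
    four sample points, which avoid \<open>E\<close>.\<close>
  have notE: "y + \<epsilon> \<notin> E" "y + 2 * \<epsilon> \<notin> E" "y - \<epsilon> \<notin> E" "y - 2 * \<epsilon> \<notin> E"
    using far[of "y + \<epsilon>"] far[of "y + 2 * \<epsilon>"] far[of "y - \<epsilon>"] far[of "y - 2 * \<epsilon>"] \<epsilon>
    by (auto simp: P_def)
  have tile: "a i \<noteq> y \<Longrightarrow> \<bar>a i - y\<bar> > 2 * \<epsilon>" "b i \<noteq> y \<Longrightarrow> \<bar>b i - y\<bar> > 2 * \<epsilon>" if "i \<in> I" for i
    using far[of "a i"] far[of "b i"] that by (auto simp: P_def)
  have big: "1 \<noteq> y \<Longrightarrow> \<bar>1 - y\<bar> > 2 * \<epsilon>" "0 \<noteq> y \<Longrightarrow> \<bar>0 - y\<bar> > 2 * \<epsilon>"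
    using far[of 1] far[of 0] by (auto simp: P_def)
  have "(\<Sum>i | i \<in> I \<and> b i = y. a i - b i) = (\<Sum>i\<in>I. if b i = y then a i - b i else 0)"
    using fin by (subst sum.inter_filter) auto
  also have "\<dots> = (\<Sum>i\<in>I. jump (slice_length (a i) (b i)) \<epsilon> y)"
    by (intro sum.cong refl) (simp add: jump_slice_length[OF ne \<epsilon> tile])
  also have "\<dots> = jump F \<epsilon> y"
    by (simp add: jump_def F_def sum_subtractf sum_distrib_left sum.distrib)
  also have "\<dots> = jump (slice_length 1 0) \<epsilon> y"
    using notE by (simp add: jump_def F_def slices)
  also have "\<dots> = of_bool (y = 0)"
    using jump_slice_length[OF _ \<epsilon> big] by (simp add: eq_commute[of 0 y])
  finally show "(\<Sum>i | i \<in> I \<and> b i = y. a i - b i) = of_bool (y = 0)" .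
  have "\<epsilon> * (real (card {i \<in> I. a i = y}) - real (card {i \<in> I. b i = y}))
      = (\<Sum>i\<in>I. \<epsilon> * (of_bool (a i = y) - of_bool (b i = y)))"
    using fin by (simp add: sum_distrib_left[symmetric] sum_subtractf sum_of_bool_eq Int_def)
  also have "\<dots> = (\<Sum>i\<in>I. kink (slice_length (a i) (b i)) \<epsilon> y)"
    by (intro sum.cong refl) (simp add: kink_slice_length[OF ne \<epsilon> tile])
  also have "\<dots> = kink F \<epsilon> y"
    by (simp add: kink_def F_def sum_subtractf sum_distrib_left sum.distrib)
  also have "\<dots> = kink (slice_length 1 0) \<epsilon> y"
    using notE by (simp add: kink_def F_def slices)
  also have "\<dots> = \<epsilon> * (of_bool (y = 1) - of_bool (y = 0))"
    using kink_slice_length[OF _ \<epsilon> big] by (simp add: eq_commute[of 1 y] eq_commute[of 0 y])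
  finally have "real (card {i \<in> I. a i = y}) - real (card {i \<in> I. b i = y}) = of_bool (y = 1) - of_bool (y = 0)"
    using \<epsilon> by simp
  then have "real_of_int (int (card {i \<in> I. a i = y}) - int (card {i \<in> I. b i = y})) 
      = real_of_int (of_bool (y = 1) - of_bool (y = 0))" by simp
  then show "int (card {i \<in> I. a i = y}) - int (card {i \<in> I. b i = y}) = of_bool (y = 1) - of_bool (y = 0)"
    by (simp only: of_int_eq_iff)
qed

section \<open>Slices of parallel triangles\<close>

context equilateral_frame
begin

text \<open>Height is the coordinate along \<open>f\<close>. The slice joins \<open>p\<close> and
  \<open>p + (q + \<mu> - y)\<close>; \<open>min\<close> and \<open>max\<close> order these ends for
  either sign of \<open>\<mu>\<close>.\<close>

lemma slice_set:
  assumes "\<mu> \<noteq> 0"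
  shows "{x. A + x *\<^sub>R e + y *\<^sub>R f \<in> tri (A + p *\<^sub>R e + q *\<^sub>R f) \<mu>}
    = (if min (q + \<mu>) q \<le> y \<and> y \<le> max (q + \<mu>) q
       then {p + min 0 (q + \<mu> - y) .. p + max 0 (q + \<mu> - y)} else {})"
proof -
  have *: "A + x *\<^sub>R e + y *\<^sub>R f = (A + p *\<^sub>R e + q *\<^sub>R f) + (x - p) *\<^sub>R e + (y - q) *\<^sub>R f" for x
    by (simp add: algebra_simps)
  have "A + x *\<^sub>R e + y *\<^sub>R f \<in> tri (A + p *\<^sub>R e + q *\<^sub>R f) \<mu>
    \<longleftrightarrow> 0 \<le> (x - p) / \<mu> \<and> 0 \<le> (y - q) / \<mu> \<and> (x - p) / \<mu> + (y - q) / \<mu> \<le> 1" for x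
    by (subst *) (rule mem_tri_iff[OF assms])
  moreover have "0 \<le> (x - p) / \<mu> \<and> 0 \<le> (y - q) / \<mu> \<and> (x - p) / \<mu> + (y - q) / \<mu> \<le> 1
    \<longleftrightarrow> (if \<mu> > 0 then p \<le> x \<and> q \<le> y \<and> x - p + (y - q) \<le> \<mu> else x \<le> p \<and> y \<le> q \<and> \<mu> \<le> x - p + (y - q))" for x
    using assms by (auto simp: add_divide_distrib[symmetric] zero_le_divide_iff divide_le_eq)
  ultimately show ?thesis using assms by (auto simp: min_def max_def)
qed

text \<open>Off the base height, a horizontal line meets the boundary only in the two ends of the
  slice. At the base height it contains a whole edge, hence the exclusion of
  \<open>y = q\<close>.\<close>

lemma finite_slice_frontier:
  assumes "\<mu> \<noteq> 0" "y \<noteq> q"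
  shows "finite {x. A + x *\<^sub>R e + y *\<^sub>R f \<in> tri (A + p *\<^sub>R e + q *\<^sub>R f) \<mu> - interior (tri (A + p *\<^sub>R e + q *\<^sub>R f) \<mu>)}"
proof (rule finite_subset)
  show "{x. A + x *\<^sub>R e + y *\<^sub>R f \<in> tri (A + p *\<^sub>R e + q *\<^sub>R f) \<mu> - interior (tri (A + p *\<^sub>R e + q *\<^sub>R f) \<mu>)}
    \<subseteq> {p, p + (q + \<mu> - y)}"
  proof
    fix x assume "x \<in> {x. A + x *\<^sub>R e + y *\<^sub>R f \<in> tri (A + p *\<^sub>R e + q *\<^sub>R f) \<mu> - interior (tri (A + p *\<^sub>R e + q *\<^sub>R f) \<mu>)}"
    moreover have *: "A + x *\<^sub>R e + y *\<^sub>R f = (A + p *\<^sub>R e + q *\<^sub>R f) + (x - p) *\<^sub>R e + (y - q) *\<^sub>R f"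
      by (simp add: algebra_simps)
    ultimately have x: "0 \<le> (x - p) / \<mu>" "0 \<le> (y - q) / \<mu>" "(x - p) / \<mu> + (y - q) / \<mu> \<le> 1"
      and nint: "\<not> (0 < (x - p) / \<mu> \<and> 0 < (y - q) / \<mu> \<and> (x - p) / \<mu> + (y - q) / \<mu> < 1)"
      using mem_tri_iff[OF assms(1)] interior_triI[OF assms(1)] by auto
    have "(y - q) / \<mu> \<noteq> 0" using assms by simp
    then have "(x - p) / \<mu> = 0 \<or> (x - p) / \<mu> + (y - q) / \<mu> = 1" using x nint by linarith
    then have "x - p = 0 \<or> x - p + (y - q) = \<mu>"
      using assms by (auto simp: add_divide_distrib[symmetric])
    then show "x \<in> {p, p + (q + \<mu> - y)}" by auto
  qed
qed simp

text \<open>The slices of the tiles cover the slice of the big triangle and overlap in finite sets,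
  so their Lebesgue measures add up.\<close>

lemma slice_length_sum:
  fixes p q \<mu> :: "'i \<Rightarrow> real"
  assumes fin: "finite I" and ne: "\<And>i. i \<in> I \<Longrightarrow> \<mu> i \<noteq> 0"
    and T: "\<And>i. i \<in> I \<Longrightarrow> T i = tri (A + p i *\<^sub>R e + q i *\<^sub>R f) (\<mu> i)"
    and dj: "\<And>i j. i \<in> I \<Longrightarrow> j \<in> I \<Longrightarrow> i \<noteq> j \<Longrightarrow> interior (T i) \<inter> interior (T j) = {}"
    and un: "(\<Union>i\<in>I. T i) = tri A 1" and y: "y \<notin> q ` I"
  shows "(\<Sum>i\<in>I. slice_length (q i + \<mu> i) (q i) y) = slice_length 1 0 y"
proof -
  define S where "S R = {x. A + x *\<^sub>R e + y *\<^sub>R f \<in> R}" for R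
  have meas: "S (tri (A + p *\<^sub>R e + q *\<^sub>R f) \<mu>) \<in> lmeasurable
      \<and> measure lebesgue (S (tri (A + p *\<^sub>R e + q *\<^sub>R f) \<mu>)) = slice_length (q + \<mu>) q y"
    if "\<mu> \<noteq> 0" for p q \<mu>
    unfolding S_def slice_set[OF that] slice_length_def by (auto simp: min_def max_def)
  have "(\<Sum>i\<in>I. slice_length (q i + \<mu> i) (q i) y) = (\<Sum>i\<in>I. measure lebesgue (S (T i)))"
    by (intro sum.cong refl) (simp add: T meas ne)
  also have "\<dots> = measure lebesgue (\<Union>i\<in>I. S (T i))"
  proof (rule measure_negligible_finite_Union_image[symmetric])
    show "pairwise (\<lambda>i j. negligible (S (T i) \<inter> S (T j))) I"
    proof (rule pairwiseI)
      fix i j assume ij: "i \<in> I" "j \<in> I" "i \<noteq> j"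
      have "finite (S (T i - interior (T i)))" if "i \<in> I" for i
        using finite_slice_frontier[OF ne[OF that], of y "q i" A "p i"] y that T[OF that] by (auto simp: S_def)
      then have "finite (S (T i - interior (T i)) \<union> S (T j - interior (T j)))" using ij by simp
      \<comment> \<open>No point is interior to both tiles, so a common point is a boundary point of
        at least one of them.\<close>
      moreover have "S (T i) \<inter> S (T j) \<subseteq> S (T i - interior (T i)) \<union> S (T j - interior (T j))"
        using dj[OF ij] by (auto simp: S_def)
      ultimately show "negligible (S (T i) \<inter> S (T j))" by (meson finite_subset negligible_finite)
    qed
  qed (use fin in \<open>auto simp: T meas ne\<close>)
  also have "(\<Union>i\<in>I. S (T i)) = S (tri A 1)" using un by (auto simp: S_def)
  also have "measure lebesgue \<dots> = slice_length 1 0 y" using meas[of 1 0 0] by simp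
  finally show ?thesis .
qed

lemma frame_span: obtains p q where "a = A + p *\<^sub>R e + q *\<^sub>R f"
proof -
  have "independent {e, f}"
  proof (rule independent_insertI)
    show "independent {f}" using norm_frame side_pos by (auto simp: dependent_single)
    show "e \<notin> span {f}"
    proof
      assume "e \<in> span {f}"
      then obtain k where "e = k *\<^sub>R f" by (auto simp: span_singleton)
      then have "1 *\<^sub>R e + 0 *\<^sub>R f = 0 *\<^sub>R e + k *\<^sub>R f" by simp
      then show False unfolding frame_cancel by simp
    qed
  qed
  moreover have "e \<noteq> f" using norm_frame side_pos by auto
  ultimately have "UNIV \<subseteq> span {e, f}"
    by (intro card_ge_dim_independent) auto
  then have "a - A \<in> span {e, f}" by auto
  then obtain p q where "a - A = p *\<^sub>R e + q *\<^sub>R f"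
    by (auto simp: span_insert span_singleton algebra_simps)
  then have "a = A + p *\<^sub>R e + q *\<^sub>R f" by (simp add: algebra_simps)
  then show thesis by (rule that)
qed

end

section \<open>Harmonic heights\<close>

text \<open>Multiplying out the product of the row sums gives one term for each map of indices; the
  Leibniz formula without signs keeps only the permutations.\<close>

lemma abs_det_le_prod_row_sums:
  fixes A :: "int mat"
  assumes A: "A \<in> carrier_mat n n"
  shows "\<bar>det A\<bar> \<le> (\<Prod>i<n. \<Sum>j<n. \<bar>A $$ (i, j)\<bar>)"
proof -
  let ?P = "{p. p permutes {0..<n}}"
  have "\<bar>det A\<bar> \<le> (\<Sum>p\<in>?P. \<bar>signof p * (\<Prod>i = 0..<n. A $$ (i, p i))\<bar>)"
    unfolding det_def'[OF A] by (rule sum_abs)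
  also have "\<dots> = (\<Sum>p\<in>?P. \<Prod>i<n. \<bar>A $$ (i, p i)\<bar>)"
    by (intro sum.cong refl) (simp add: abs_mult sign_def abs_prod lessThan_atLeast0)
  \<comment> \<open>Permutations fix the outside indices while members of \<open>PiE\<close> are
    \<open>undefined\<close> there; \<open>restrict\<close> translates injectively.\<close>
  also have "\<dots> = (\<Sum>g\<in>(\<lambda>p. restrict p {..<n}) ` ?P. \<Prod>i<n. \<bar>A $$ (i, g i)\<bar>)"
  proof (subst sum.reindex)
    show "inj_on (\<lambda>p. restrict p {..<n}) ?P"
    proof (rule inj_onI)
      fix p q assume pq: "p \<in> ?P" "q \<in> ?P" "restrict p {..<n} = restrict q {..<n}"
      show "p = q"
      proof
        fix x show "p x = q x"
          using pq permutes_not_in[of p "{0..<n}" x] permutes_not_in[of q "{0..<n}" x]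
          by (cases "x < n") (auto dest: fun_cong[of _ _ x])
      qed
    qed
  qed (auto intro!: sum.cong)
  also have "\<dots> \<le> (\<Sum>g\<in>PiE {..<n} (\<lambda>_. {..<n}). \<Prod>i<n. \<bar>A $$ (i, g i)\<bar>)"
  proof (rule sum_mono2)
    show "(\<lambda>p. restrict p {..<n}) ` ?P \<subseteq> PiE {..<n} (\<lambda>_. {..<n})"
      using permutes_in_image by fastforce
  qed (auto intro!: finite_PiE prod_nonneg)
  also have "\<dots> = (\<Prod>i<n. \<Sum>j<n. \<bar>A $$ (i, j)\<bar>)"
    by (rule prod_sum_PiE[symmetric]) auto
  finally show ?thesis .
qed

text \<open>Cubing turns this into \<open>8 * d ^ 3 \<le> 16 ^ d\<close>; for
  \<open>d \<ge> 1\<close> the cube grows by a factor of at most 8 from \<open>d\<close> to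
  \<open>d + 1\<close>.\<close>

lemma two_mult_le_powr: "2 * real d \<le> 4 powr (2 * real d / 3)"
proof (rule power_le_imp_le_base)
  have "8 * real d ^ 3 \<le> 16 ^ d"
  proof (induction d)
    case (Suc d)
    show ?case
    proof (cases "d = 0")
      case False
      then have d: "1 \<le> real d" by simp
      then have "real d \<le> real d ^ 3" "real d ^ 2 \<le> real d ^ 3" "1 \<le> real d ^ 3"
        using power_increasing[of 1 3 "real d"] power_increasing[of 2 3 "real d"] by auto
      moreover have "real (Suc d) ^ 3 = real d ^ 3 + 3 * real d ^ 2 + 3 * real d + 1"
        by (simp add: power3_eq_cube power2_eq_square algebra_simps)
      ultimately have "real (Suc d) ^ 3 \<le> 16 * real d ^ 3" by linarith
      then show ?thesis using Suc.IH by simp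
    qed simp
  qed simp
  moreover have "(4 powr (2 * real d / 3)) ^ 3 = (16::real) ^ d"
  proof -
    have "(4 powr (2 * real d / 3)) ^ 3 = (4::real) powr (2 * real d)"
      by (simp flip: powr_realpow[of "4 powr _"] add: powr_powr)
    also have "\<dots> = (4 powr 2) powr real d" by (simp only: powr_powr)
    finally show ?thesis by (simp add: powr_realpow)
  qed
  ultimately show "(2 * real d) ^ Suc 2 \<le> (4 powr (2 * real d / 3)) ^ Suc 2"
    by (simp add: power_mult_distrib numeral_3_eq_3 flip: numeral_3_eq_3)
qed simp

text \<open>What remains of a tiling when only base and apex heights are kept. The heights in
  \<open>V\<close> are the unknowns; apexes outside \<open>V\<close> lie at the known heights 0 and
  1.\<close>

locale height_system =
  fixes I :: "'i set" and a b :: "'i \<Rightarrow> real" and V :: "real set"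
  assumes finite_I: "finite I"
    and V_def: "V = b ` I - {0}"
    and base_neq_apex: "i \<in> I \<Longrightarrow> a i \<noteq> b i"
    and apex_mem: "i \<in> I \<Longrightarrow> a i \<in> V \<union> {0, 1}"
    and balance: "y \<in> V \<Longrightarrow> (\<Sum>i | i \<in> I \<and> b i = y. a i - b i) = 0"
    and ground: "\<exists>i\<in>I. b i = 0"
begin

definition "J y = {i \<in> I. b i = y}"

lemma finite_V: "finite V" and finite_J: "finite (J y)"
  using finite_I by (auto simp: V_def J_def)

text \<open>Among the maximum points of a harmonic function, the highest one has an apex strictly above it.\<close>

lemma harmonic_nonpos:
  fixes X :: "real \<Rightarrow> real"
  assumes out: "\<And>w. w \<notin> V \<Longrightarrow> X w = 0"
    and harm: "\<And>y. y \<in> V \<Longrightarrow> real (card (J y)) * X y = (\<Sum>i\<in>J y. X (a i))"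
  shows "X y \<le> 0"
proof (rule ccontr)
  assume "\<not> X y \<le> 0"
  then have pos: "X y > 0" and "y \<in> V" using out by force+
  define M where "M = Max (X ` V)"
  have le: "X w \<le> M" if "w \<in> V" for w using that finite_V by (simp add: M_def)
  have "M > 0" using le[OF \<open>y \<in> V\<close>] pos by simp
  have le': "X w \<le> M" for w using le[of w] out[of w] \<open>M > 0\<close> by force
  define W where "W = {w \<in> V. X w = M}"
  have "M \<in> X ` V" unfolding M_def using finite_V \<open>y \<in> V\<close> by (intro Max_in) auto
  then have W: "finite W" "W \<noteq> {}" using finite_V by (auto simp: W_def)
  define w where "w = Max W"
  have "w \<in> W" using W unfolding w_def by (rule Max_in)
  then have w: "w \<in> V" "X w = M" by (auto simp: W_def)
  \<comment> \<open>\<open>M\<close> is the average of values that do not exceed \<open>M\<close>,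
    so all of them equal \<open>M\<close>. As \<open>M > 0\<close>, these apexes lie in
    \<open>V\<close>.\<close>
  have "(\<Sum>i\<in>J w. M - X (a i)) = 0" using harm[OF w(1)] w(2) by (simp add: sum_subtractf)
  then have eq: "X (a i) = M" if "i \<in> J w" for i
    using sum_nonneg_eq_0_iff[OF finite_J, of w "\<lambda>i. M - X (a i)"] le' that by force
  have up: "a i \<le> w" if "i \<in> J w" for i
  proof -
    have "a i \<in> W" using eq[OF that] \<open>M > 0\<close> out[of "a i"] by (force simp: W_def)
    then show ?thesis using W by (simp add: w_def)
  qed
  \<comment> \<open>By \<open>balance\<close> the apexes have average height \<open>w\<close>. None
    lies above \<open>w\<close>, so all lie at \<open>w\<close>, contradicting
    \<open>base_neq_apex\<close>.\<close>
  have "(\<Sum>i\<in>J w. w - a i) = - (\<Sum>i\<in>J w. a i - b i)"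
    by (subst sum_negf[symmetric]) (auto intro!: sum.cong simp: J_def)
  also have "\<dots> = 0" using balance[OF w(1)] by (simp add: J_def)
  finally have "\<forall>i\<in>J w. w - a i = 0"
    using sum_nonneg_eq_0_iff[OF finite_J, of w "\<lambda>i. w - a i"] up by simp
  moreover obtain i where "i \<in> J w" using w by (auto simp: V_def J_def)
  ultimately show False using base_neq_apex[of i] by (auto simp: J_def)
qed

lemma harmonic_zero:
  fixes X :: "real \<Rightarrow> real"
  assumes out: "\<And>w. w \<notin> V \<Longrightarrow> X w = 0"
    and harm: "\<And>y. y \<in> V \<Longrightarrow> real (card (J y)) * X y = (\<Sum>i\<in>J y. X (a i))"
  shows "X y = 0"
proof -
  have "- X y \<le> 0"
    by (rule harmonic_nonpos[of "\<lambda>w. - X w"]) (use out harm in \<open>auto simp: sum_negf\<close>)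
  then show ?thesis using harmonic_nonpos[of X y] out harm by force
qed

lemma integral_multiple:
  obtains D :: int where "D > 0" "D \<le> 4 powr ((2 * real (card I) - 2) / 3)"
    "\<And>i. i \<in> I \<Longrightarrow> of_int D * (a i - b i) \<in> \<int>"
proof -
  define n where "n = card V"
  obtain v where v: "bij_betw v {..<n} V"
    using ex_bij_betw_nat_finite[OF finite_V] by (auto simp: n_def lessThan_atLeast0)
  have vV: "v j \<in> V" if "j < n" for j using v that by (auto simp: bij_betw_def)
  have v_eq: "v j = v k \<longleftrightarrow> j = k" if "j < n" "k < n" for j k
    using v that by (auto simp: bij_betw_def inj_on_def)
  define C where "C j k = card {i \<in> J (v j). a i = v k}" for j k
  \<comment> \<open>The Laplacian of the digraph on \<open>V\<close>: out-degrees on the diagonal,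
    minus the numbers \<open>C j k\<close> of arcs. Arcs that leave \<open>V\<close> enter only
    through the right-hand side \<open>r\<close>.\<close>
  define M :: "int mat" where
    "M = mat n n (\<lambda>(j, k). (if j = k then int (card (J (v j))) else 0) - int (C j k))"
  have M: "M \<in> carrier_mat n n" by (simp add: M_def)
  have row: "(\<Sum>k<n. of_int (M $$ (j, k)) * X (v k))
      = real (card (J (v j))) * X (v j) - (\<Sum>i | i \<in> J (v j) \<and> a i \<in> V. X (a i))"
    if "j < n" for j and X :: "real \<Rightarrow> real"
  proof -
    have "(\<Sum>k<n. of_int (M $$ (j, k)) * X (v k))
        = (\<Sum>k<n. (if k = j then real (card (J (v j))) * X (v k) else 0)) - (\<Sum>k<n. real (C j k) * X (v k))"
      unfolding sum_subtractf[symmetric] using that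
      by (intro sum.cong) (auto simp: M_def algebra_simps)
    also have "(\<Sum>k<n. (if k = j then real (card (J (v j))) * X (v k) else 0)) = real (card (J (v j))) * X (v j)"
      using that by (simp add: sum.delta)
    also have "(\<Sum>k<n. real (C j k) * X (v k)) = (\<Sum>k<n. \<Sum>i | i \<in> J (v j) \<and> a i = v k. X (a i))"
      by (simp add: C_def)
    also have "\<dots> = (\<Sum>y\<in>V. \<Sum>i | i \<in> J (v j) \<and> a i = y. X (a i))"
      using sum.reindex_bij_betw[OF v, of "\<lambda>y. \<Sum>i | i \<in> J (v j) \<and> a i = y. X (a i)"] by simp
    also have "\<dots> = (\<Sum>y\<in>V. \<Sum>i | i \<in> {i \<in> J (v j). a i \<in> V} \<and> a i = y. X (a i))"
      by (intro sum.cong) auto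
    also have "\<dots> = (\<Sum>i | i \<in> J (v j) \<and> a i \<in> V. X (a i))"
      by (rule sum.group) (use finite_J finite_V in auto)
    finally show ?thesis .
  qed
  have "det M \<noteq> 0"
  proof
    assume "det M = 0"
    then obtain z where z: "z \<in> carrier_vec n" "z \<noteq> 0\<^sub>v n" "M *\<^sub>v z = 0\<^sub>v n"
      using det_0_iff_vec_prod_zero[OF M] by auto
    \<comment> \<open>The kernel vector, extended by zero off \<open>V\<close>, is harmonic and
      therefore zero.\<close>
    define X where "X w = (if w \<in> V then of_int (vec_index z (inv_into {..<n} v w)) else 0 :: real)" for w
    have Xv: "X (v k) = of_int (vec_index z k)" if "k < n" for k
      using vV[OF that] v that by (simp add: X_def bij_betw_def)
    have "X y = 0" for y
    proof (rule harmonic_zero[of X])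
      fix y assume "y \<in> V"
      then obtain j where j: "j < n" "y = v j" using v by (auto simp: bij_betw_def)
      have "0 = vec_index (M *\<^sub>v z) j" using z j by simp
      also have "\<dots> = (\<Sum>k<n. M $$ (j, k) * vec_index z k)"
        using M z(1) j by (simp add: scalar_prod_def lessThan_atLeast0)
      finally have "(\<Sum>k<n. M $$ (j, k) * vec_index z k) = 0" by simp
      then have "(\<Sum>k<n. real_of_int (M $$ (j, k)) * X (v k)) = 0"
        using Xv by (simp flip: of_int_mult of_int_sum)
      then have "real (card (J y)) * X y = (\<Sum>i | i \<in> J y \<and> a i \<in> V. X (a i))"
        using row[OF j(1), of X] j(2) by simp
      also have "\<dots> = (\<Sum>i\<in>J y. X (a i))"
        by (rule sum.mono_neutral_left) (auto simp: finite_J X_def)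
      finally show "real (card (J y)) * X y = (\<Sum>i\<in>J y. X (a i))" .
    qed (simp add: X_def)
    then have "vec_index z k = 0" if "k < n" for k using Xv[OF that] by simp
    then have "z = 0\<^sub>v n" using z(1) by (intro eq_vecI) auto
    then show False using z(2) by simp
  qed
  define r where "r j = (\<Sum>k<n. of_int (M $$ (j, k)) * v k)" for j
  have r_int: "r j \<in> \<int>" if "j < n" for j
  proof -
    have "real (card (J (v j))) * v j = (\<Sum>i\<in>J (v j). a i)"
      using balance[OF vV[OF that]] by (simp add: sum_subtractf J_def)
    also have "\<dots> = (\<Sum>i | i \<in> J (v j) \<and> a i \<in> V. a i) + (\<Sum>i | i \<in> J (v j) \<and> a i \<notin> V. a i)"
      by (subst sum.union_disjoint[symmetric]) (auto simp: finite_J intro!: sum.cong)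
    finally have "r j = (\<Sum>i | i \<in> J (v j) \<and> a i \<notin> V. a i)"
      using row[OF that, of "\<lambda>x. x"] by (simp add: r_def)
    \<comment> \<open>Each remaining apex height is 0 or 1.\<close>
    also have "\<dots> \<in> \<int>"
      by (rule Ints_sum) (use apex_mem in \<open>fastforce simp: J_def\<close>)
    finally show ?thesis .
  qed
  \<comment> \<open>Cramer's rule in adjugate form: multiplying the system for the heights by the
    integer matrix \<open>adj_mat M\<close> leaves \<open>det M\<close> times each height on one
    side and integers on the other.\<close>
  have det_v: "of_int (det M) * v k \<in> \<int>" if k: "k < n" for k
  proof -
    have A: "adj_mat M \<in> carrier_mat n n" "adj_mat M * M = det M \<cdot>\<^sub>m 1\<^sub>m n"
      using adj_mat[OF M] by auto
    have entry: "(\<Sum>j<n. adj_mat M $$ (k, j) * M $$ (j, l)) = (if k = l then det M else 0)" if "l < n" for l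
    proof -
      have "(\<Sum>j<n. adj_mat M $$ (k, j) * M $$ (j, l)) = (adj_mat M * M) $$ (k, l)"
        using A(1) M that k by (simp add: scalar_prod_def lessThan_atLeast0)
      then show ?thesis unfolding A(2) using that k by simp
    qed
    have "(\<Sum>j<n. of_int (adj_mat M $$ (k, j)) * r j)
        = (\<Sum>l<n. of_int (\<Sum>j<n. adj_mat M $$ (k, j) * M $$ (j, l)) * v l)"
      unfolding r_def sum_distrib_left of_int_sum sum_distrib_right
      by (subst sum.swap) (simp add: mult.assoc)
    also have "\<dots> = (\<Sum>l<n. if l = k then of_int (det M) * v l else 0)"
      by (intro sum.cong refl) (auto simp: entry)
    also have "\<dots> = of_int (det M) * v k" using k by (simp add: sum.delta)
    finally show ?thesis using r_int by (metis (no_types, lifting) Ints_mult Ints_of_int Ints_sum lessThan_iff)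
  qed
  have int_V: "of_int \<bar>det M\<bar> * y \<in> \<int>" if "y \<in> V \<union> {0, 1}" for y
  proof (cases "y \<in> V")
    case True
    then obtain k where "k < n" "y = v k" using v by (auto simp: bij_betw_def)
    then show ?thesis using det_v[of k] by (auto simp: abs_if)
  qed (use that in auto)
  have int_bound: "\<bar>det M\<bar> \<le> (\<Prod>j<n. 2 * int (card (J (v j))))"
  proof -
    \<comment> \<open>Each tile of the row counts once on the diagonal and at most once, through its
      apex, among the \<open>C j k\<close>.\<close>
    have "(\<Sum>k<n. \<bar>M $$ (j, k)\<bar>) \<le> 2 * int (card (J (v j)))" if j: "j < n" for j
    proof -
      have "(\<Sum>k<n. \<bar>M $$ (j, k)\<bar>) \<le> (\<Sum>k<n. (if k = j then int (card (J (v j))) else 0) + int (C j k))"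
        by (rule sum_mono) (use j in \<open>auto simp: M_def\<close>)
      also have "\<dots> = int (card (J (v j))) + int (\<Sum>k<n. C j k)"
        using j by (simp add: sum.distrib sum.delta)
      also have "(\<Sum>k<n. C j k) = card (\<Union>k<n. {i \<in> J (v j). a i = v k})"
        unfolding C_def by (rule card_UN_disjoint[symmetric]) (auto simp: finite_J v_eq)
      also have "\<dots> \<le> card (J (v j))" by (rule card_mono) (auto simp: finite_J)
      finally show ?thesis by simp
    qed
    then have "(\<Prod>j<n. \<Sum>k<n. \<bar>M $$ (j, k)\<bar>) \<le> (\<Prod>j<n. 2 * int (card (J (v j))))"
      by (intro prod_mono) (auto intro: sum_nonneg)
    then show ?thesis using abs_det_le_prod_row_sums[OF M] by linarith
  qed
  have "real_of_int \<bar>det M\<bar> \<le> (\<Prod>j<n. 2 * real (card (J (v j))))"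
  proof -
    have "real_of_int \<bar>det M\<bar> \<le> real_of_int (\<Prod>j<n. 2 * int (card (J (v j))))"
      using int_bound by (simp only: of_int_le_iff)
    then show ?thesis by simp
  qed
  also have "\<dots> \<le> (\<Prod>j<n. 4 powr (2 * real (card (J (v j))) / 3))"
    by (intro prod_mono) (auto simp: two_mult_le_powr)
  also have "\<dots> = 4 powr (\<Sum>j<n. 2 * real (card (J (v j))) / 3)"
    by (simp add: powr_sum)
  also have "(\<Sum>j<n. 2 * real (card (J (v j))) / 3) = 2 * real (\<Sum>j<n. card (J (v j))) / 3"
    by (simp add: sum_distrib_left sum_divide_distrib)
  also have "(\<Sum>j<n. card (J (v j))) = card (\<Union>j<n. J (v j))"
    by (rule card_UN_disjoint[symmetric]) (auto simp: finite_J, auto simp: J_def v_eq)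
  also have "4 powr (2 * real (card (\<Union>j<n. J (v j))) / 3) \<le> 4 powr ((2 * real (card I) - 2) / 3)"
  proof -
    obtain i where i: "i \<in> I" "b i = 0" using ground by auto
    \<comment> \<open>\<open>V\<close> omits 0, so the ground tile \<open>i\<close> belongs to no
      row; this saves the 2 in the exponent.\<close>
    have "(\<Union>j<n. J (v j)) \<subseteq> I - {i}" using i vV by (auto simp: J_def V_def)
    then have "card (\<Union>j<n. J (v j)) \<le> card (I - {i})" using finite_I by (intro card_mono) auto
    also have "\<dots> = card I - 1" using i by simp
    finally have "real (card (\<Union>j<n. J (v j))) \<le> real (card I) - 1"
      using i finite_I card_gt_0_iff[of I] by (auto simp: of_nat_diff)
    then show ?thesis by simp
  qed
  finally have bound: "real_of_int \<bar>det M\<bar> \<le> 4 powr ((2 * real (card I) - 2) / 3)" .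
  show thesis
  proof (rule that[of "\<bar>det M\<bar>"])
    show "of_int \<bar>det M\<bar> * (a i - b i) \<in> \<int>" if "i \<in> I" for i
    proof -
      have "b i \<in> V \<union> {0, 1}" using that by (auto simp: V_def)
      then show ?thesis unfolding right_diff_distrib using int_V apex_mem[OF that] by (intro Ints_diff) auto
    qed
  qed (use bound \<open>det M \<noteq> 0\<close> in auto)
qed

end

section \<open>From a tiling to its height system\<close>

lemma (in equilateral_frame) integral_tiling_of_tri:
  assumes til: "tiling \<T> (tri A 1)" and eq: "\<forall>T\<in>\<T>. equilateral_triangle T"
  obtains D :: int where "D > 0" "D \<le> 4 powr ((2 * real (card \<T>) - 2) / 3)"
    "\<And>T. T \<in> \<T> \<Longrightarrow> \<exists>a \<mu>. \<mu> \<noteq> 0 \<and> T = tri a \<mu> \<and> of_int D * \<mu> \<in> \<int>"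
proof -
  have "\<exists>p q \<mu>. \<mu> \<noteq> 0 \<and> T = tri (A + p *\<^sub>R e + q *\<^sub>R f) \<mu>" if T: "T \<in> \<T>" for T
  proof -
    obtain a \<mu> where "\<mu> \<noteq> 0" "T = tri a \<mu>"
      using all_tiles_aligned[OF til eq T] unfolding aligned_def by auto
    moreover obtain p q where "a = A + p *\<^sub>R e + q *\<^sub>R f" by (rule frame_span)
    ultimately show ?thesis by blast
  qed
  then obtain p q \<mu> where tile: "\<And>T. T \<in> \<T> \<Longrightarrow> \<mu> T \<noteq> 0"
    "\<And>T. T \<in> \<T> \<Longrightarrow> T = tri (A + p T *\<^sub>R e + q T *\<^sub>R f) (\<mu> T)"
    by metis
  have fin: "finite \<T>" using til by (simp add: tiling_def)
  \<comment> \<open>Apex height; the base is at \<open>q T\<close>, so the signed scale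
    \<open>\<mu> T\<close> is the difference that \<open>integral_multiple\<close> makes
    integral.\<close>
  define a where "a T = q T + \<mu> T" for T
  have ne: "a T \<noteq> q T" if "T \<in> \<T>" for T using tile(1)[OF that] by (simp add: a_def)
  have slices: "(\<Sum>T\<in>\<T>. slice_length (a T) (q T) y) = slice_length 1 0 y" if "y \<notin> q ` \<T>" for y
    unfolding a_def
    by (rule slice_length_sum[where T = "\<lambda>T. T", OF fin tile])
      (use til that in \<open>auto simp: tiling_def pairwise_def\<close>)
  note bal = base_balance[OF fin finite_imageI[OF fin, of q] ne slices]
  note apx = apex_balance[OF fin finite_imageI[OF fin, of q] ne slices]
  interpret height_system \<T> a q "q ` \<T> - {0}"
  proof
    show "a T \<in> (q ` \<T> - {0}) \<union> {0, 1}" if "T \<in> \<T>" for T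
    proof (rule ccontr)
      assume no: "a T \<notin> (q ` \<T> - {0}) \<union> {0, 1}"
      then have "{S \<in> \<T>. q S = a T} = {}" by (auto simp: image_iff)
      then have "card {S \<in> \<T>. q S = a T} = 0" by (simp only: card.empty)
      \<comment> \<open>Away from 0 and 1 there are as many apexes as bases at each height, so an
        apex cannot occur at a height without bases.\<close>
      moreover have "card {S \<in> \<T>. a S = a T} > 0" using that fin by (auto simp: card_gt_0_iff)
      ultimately show False using apx[where y = "a T"] no by simp
    qed
    show "\<exists>T\<in>\<T>. q T = 0"
    proof (rule ccontr)
      assume "\<not> (\<exists>T\<in>\<T>. q T = 0)"
      \<comment> \<open>By \<open>bal\<close> this sum is 1 at height 0, so it cannot be
        empty.\<close>
      then have "(\<Sum>T | T \<in> \<T> \<and> q T = 0. a T - q T) = 0" by (intro sum.neutral) auto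
      then show False using bal[where y = 0] by simp
    qed
  qed (use fin ne bal in auto)
  show thesis
  proof (rule integral_multiple)
    fix D :: int
    assume D: "D > 0" "D \<le> 4 powr ((2 * real (card \<T>) - 2) / 3)"
      "\<And>T. T \<in> \<T> \<Longrightarrow> of_int D * (a T - q T) \<in> \<int>"
    show thesis
    proof (rule that[OF D(1,2)])
      show "\<exists>a \<mu>. \<mu> \<noteq> 0 \<and> T = tri a \<mu> \<and> of_int D * \<mu> \<in> \<int>" if "T \<in> \<T>" for T
        using tile[OF that] D(3)[OF that] unfolding a_def by auto
    qed
  qed
qed

theorem theorem7p5:
  fixes \<Delta> :: "(real ^ 2) set" and \<T> :: "(real ^ 2) set set" and n :: nat
  assumes "equilateral_triangle \<Delta>"
    and "tiling \<T> \<Delta>"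
    and "\<forall>T\<in>\<T>. equilateral_triangle T"
    and "card \<T> = n"
  shows "\<exists>c::real. c > 0 \<and>
    (\<exists>s. equilateral_triangle_with_side ((\<lambda>x. c *\<^sub>R x) ` \<Delta>) s \<and>
         s \<le> 4 powr ((2 * real n - 2) / 3)) \<and>
    (\<forall>T\<in>\<T>. \<exists>t. equilateral_triangle_with_side ((\<lambda>x. c *\<^sub>R x) ` T) t \<and> t \<in> \<int>)"
proof -
  obtain s where "equilateral_triangle_with_side \<Delta> s"
    using assms(1) unfolding equilateral_triangle_def by auto
  then obtain A e f where fr: "equilateral_frame e f s" and \<Delta>: "\<Delta> = equilateral_frame.tri e f A 1"
    by (rule equilateral_triangle_frame)
  interpret equilateral_frame e f s by (rule fr)
  obtain D :: int where D: "D > 0" "D \<le> 4 powr ((2 * real n - 2) / 3)"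
    "\<And>T. T \<in> \<T> \<Longrightarrow> \<exists>a \<mu>. \<mu> \<noteq> 0 \<and> T = tri a \<mu> \<and> of_int D * \<mu> \<in> \<int>"
    using integral_tiling_of_tri assms unfolding \<Delta> by metis
  \<comment> \<open>This factor gives the big triangle side exactly \<open>D\<close> and a tile of
    scale \<open>\<mu>\<close> the side \<open>\<bar>D * \<mu>\<bar>\<close>.\<close>
  define c where "c = of_int D / s"
  have c: "c > 0" "c * s = of_int D" using D(1) side_pos by (simp_all add: c_def)
  have side: "equilateral_triangle_with_side ((\<lambda>x. c *\<^sub>R x) ` tri a \<mu>) \<bar>of_int D * \<mu>\<bar>" if "\<mu> \<noteq> 0" for a \<mu>
  proof -
    have "\<bar>c * \<mu>\<bar> * s = \<bar>of_int D * \<mu>\<bar>"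
      using c(1) side_pos unfolding c(2)[symmetric] by (simp add: abs_mult)
    moreover have "c * \<mu> \<noteq> 0" using c(1) that by simp
    ultimately show ?thesis
      unfolding scaled_tri using triangle_with_side_tri[of "c * \<mu>" "c *\<^sub>R a"] by metis
  qed
  show ?thesis
  proof (rule exI[of _ c], intro conjI ballI)
    show "c > 0" by (rule c)
    show "\<exists>s. equilateral_triangle_with_side ((\<lambda>x. c *\<^sub>R x) ` \<Delta>) s \<and> s \<le> 4 powr ((2 * real n - 2) / 3)"
      using side[of 1 A] D(1,2) by (auto simp: \<Delta>)
    fix T assume "T \<in> \<T>"
    then obtain a \<mu> where T: "\<mu> \<noteq> 0" "T = tri a \<mu>" "of_int D * \<mu> \<in> \<int>" using D(3) by blast
    have "\<bar>of_int D * \<mu>\<bar> \<in> \<int>" using T(3) by (auto simp: abs_if)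
    then show "\<exists>t. equilateral_triangle_with_side ((\<lambda>x. c *\<^sub>R x) ` T) t \<and> t \<in> \<int>"
      using side[OF T(1), of a] T(2) by blast
  qed
qed

end
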